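(* Fix $a\in[1/4,1/2)$. For every $m\ge2$, put $$q_m=\frac1m,\qquad c_m=\frac{1-2a}{2^m-2}.$$ There is an exchangeable all-null score vector $(W_1,\ldots,W_m)$ with standard normal margins, a joint density that can be chosen positive everywhere, and both conditional sign probabilities $\mathbb P(W_j>0\mid|W_j|,W_{-j})$ and $\mathbb P(W_j<0\mid|W_j|,W_{-j})$ positive almost surely for every $j$, such that, with $I_q$ and $M_{\mathcal H_0}^-$ as defined in the context and $\mathrm{FDR}(q)$ the FDR of the knockoff+ threshold run at level $q$, $$\mathrm{FDR}(q_m)=q_mI_{q_m}=a,\qquad M_{\mathcal H_0}^-=1+m(a-c_m).$$ Consequently, for every fixed $a\in[1/4,1/2)$, $$\frac{\mathrm{FDR}(q_m)}{q_mM_{\mathcal H_0}^-}=\frac{a}{a-c_m+1/m}\longrightarrow1\qquad(m\to\infty).$$ Thus the bound $\mathrm{FDR}(q_m)\le q_mI_{q_m}$ holds with equality, while $\mathrm{FDR}(q_m)/(q_mM_{\mathcal H_0}^-)\to1$ along $q_m=1/m\to0$.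
   Context: "All-null" means the set of true nulls is $\mathcal H_0=\{1,\ldots,m\}$. For $t>0$, put $N_+(t)=\#\{i:W_i\ge t\}$, $N_-(t)=\#\{i:W_i\le -t\}$, $\mathcal T=\{|W_i|:|W_i|>0\}$. The knockoff+ threshold at level $q$ is $\widehat t=\widehat t(W;q)=\min\{t\in\mathcal T:(1+N_-(t))/(N_+(t)\vee1)\le q\}$, with $\widehat t=\infty$ if the set is empty; the rejection set is $\widehat{\mathcal R}=\{i:W_i\ge\widehat t\}$, and $\mathrm{FDR}=\mathbb E\{|\widehat{\mathcal R}\cap\mathcal H_0|/(|\widehat{\mathcal R}|\vee1)\}$, where $a\vee b=\max\{a,b\}$. $W_{-j}$ denotes all scores except $W_j$. For each null $j$, let $$\Omega_j=\frac{\mathbb P(W_j>0\mid|W_j|,W_{-j})}{\mathbb P(W_j<0\mid|W_j|,W_{-j})}.$$ Let $W^{(j)}$ be $W$ with $W_j$ replaced by $|W_j|$, let $\widehat t_j(q)=\widehat t(W^{(j)};q)$, and let $\mathcal A_q=\{j\in\mathcal H_0:W_j\le-\widehat t_j(q)\}$. Define $$I_q=\mathbb E\Big[\mathbf 1\{\mathcal A_q\ne\varnothing\}\frac1{|\mathcal A_q|}\sum_{j\in\mathcal A_q}\Omega_j\Big],\qquad M_{\mathcal H_0}^-=\mathbb E\Big[1\vee\max_{j\in\mathcal H_0,\,W_j<0}\Omega_j\Big],$$ where the inner maximum is zero when its index set is empty. *)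

theory Defs
  imports "HOL-Probability.Probability" "HOL-Combinatorics.Combinatorics"
begin

text \<open>A score vector is a point of the space of \<^term>\<open>Pi\<^sub>M I (\<lambda>_. borel)\<close> for a finite index set
  \<^term>\<open>I\<close>. The threshold is an extended real so that it can take the value \<open>\<infinity>\<close>.\<close>

definition N_plus :: "'i set \<Rightarrow> ('i \<Rightarrow> real) \<Rightarrow> real \<Rightarrow> nat" where
  "N_plus I w t = card {i \<in> I. w i \<ge> t}"

definition N_minus :: "'i set \<Rightarrow> ('i \<Rightarrow> real) \<Rightarrow> real \<Rightarrow> nat" where
  "N_minus I w t = card {i \<in> I. w i \<le> - t}"

definition candidates :: "'i set \<Rightarrow> ('i \<Rightarrow> real) \<Rightarrow> real set" where
  "candidates I w = {\<bar>w i\<bar> | i. i \<in> I \<and> \<bar>w i\<bar> > 0}"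

definition admissible :: "'i set \<Rightarrow> ('i \<Rightarrow> real) \<Rightarrow> real \<Rightarrow> real set" where
  "admissible I w q =
    {t \<in> candidates I w. (1 + real (N_minus I w t)) / real (max (N_plus I w t) 1) \<le> q}"

definition knockoff_threshold :: "'i set \<Rightarrow> ('i \<Rightarrow> real) \<Rightarrow> real \<Rightarrow> ereal" where
  "knockoff_threshold I w q =
    (if admissible I w q = {} then \<infinity> else ereal (Min (admissible I w q)))"

definition rejections :: "'i set \<Rightarrow> ('i \<Rightarrow> real) \<Rightarrow> real \<Rightarrow> 'i set" where
  "rejections I w q = {i \<in> I. ereal (w i) \<ge> knockoff_threshold I w q}"

definition FDR :: "'i set \<Rightarrow> 'i set \<Rightarrow> 'w measure \<Rightarrow> ('w \<Rightarrow> 'i \<Rightarrow> real) \<Rightarrow> real \<Rightarrow> real" where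
  "FDR I H0 M W q =
    (LINT \<omega>|M. real (card (rejections I (W \<omega>) q \<inter> H0)) / real (max (card (rejections I (W \<omega>) q)) 1))"

definition mask_sign :: "'i \<Rightarrow> ('i \<Rightarrow> real) \<Rightarrow> 'i \<Rightarrow> real" where
  "mask_sign j w = w(j := \<bar>w j\<bar>)"

text \<open>The \<open>\<sigma>\<close>-algebra generated by \<open>|W\<^sub>j|\<close> and \<open>W\<^sub>-\<^sub>j\<close>: these are exactly the coordinates of
  the vector with masked sign.\<close>

definition masked_algebra :: "'i set \<Rightarrow> 'w measure \<Rightarrow> ('w \<Rightarrow> 'i \<Rightarrow> real) \<Rightarrow> 'i \<Rightarrow> 'w measure" where
  "masked_algebra I M W j =
    vimage_algebra (space M) (\<lambda>\<omega>. mask_sign j (W \<omega>)) (Pi\<^sub>M I (\<lambda>_. borel))"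

definition pos_sign_prob ::
    "'i set \<Rightarrow> 'w measure \<Rightarrow> ('w \<Rightarrow> 'i \<Rightarrow> real) \<Rightarrow> 'i \<Rightarrow> 'w \<Rightarrow> real" where
  "pos_sign_prob I M W j =
    real_cond_exp M (masked_algebra I M W j) (indicator {\<omega> \<in> space M. W \<omega> j > 0})"

definition neg_sign_prob ::
    "'i set \<Rightarrow> 'w measure \<Rightarrow> ('w \<Rightarrow> 'i \<Rightarrow> real) \<Rightarrow> 'i \<Rightarrow> 'w \<Rightarrow> real" where
  "neg_sign_prob I M W j =
    real_cond_exp M (masked_algebra I M W j) (indicator {\<omega> \<in> space M. W \<omega> j < 0})"

definition sign_odds ::
    "'i set \<Rightarrow> 'w measure \<Rightarrow> ('w \<Rightarrow> 'i \<Rightarrow> real) \<Rightarrow> 'i \<Rightarrow> 'w \<Rightarrow> real" where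
  "sign_odds I M W j \<omega> = pos_sign_prob I M W j \<omega> / neg_sign_prob I M W j \<omega>"

definition active_nulls :: "'i set \<Rightarrow> 'i set \<Rightarrow> ('i \<Rightarrow> real) \<Rightarrow> real \<Rightarrow> 'i set" where
  "active_nulls I H0 w q =
    {j \<in> H0. ereal (w j) \<le> - knockoff_threshold I (mask_sign j w) q}"

text \<open>The next two expectations are Bochner integrals of real functions, which are \<open>0\<close> for a
  non-integrable integrand. A nonzero value therefore entails integrability.\<close>

definition I_functional ::
    "'i set \<Rightarrow> 'i set \<Rightarrow> 'w measure \<Rightarrow> ('w \<Rightarrow> 'i \<Rightarrow> real) \<Rightarrow> real \<Rightarrow> real" where
  "I_functional I H0 M W q =
    (LINT \<omega>|M. (if active_nulls I H0 (W \<omega>) q \<noteq> {}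
       then 1 / real (card (active_nulls I H0 (W \<omega>) q))
              * (\<Sum>j \<in> active_nulls I H0 (W \<omega>) q. sign_odds I M W j \<omega>)
       else 0))"

definition M_minus :: "'i set \<Rightarrow> 'i set \<Rightarrow> 'w measure \<Rightarrow> ('w \<Rightarrow> 'i \<Rightarrow> real) \<Rightarrow> real" where
  "M_minus I H0 M W =
    (LINT \<omega>|M. max 1 (if {j \<in> H0. W \<omega> j < 0} = {} then 0
                      else Max ((\<lambda>j. sign_odds I M W j \<omega>) ` {j \<in> H0. W \<omega> j < 0})))"

definition exchangeable :: "'i set \<Rightarrow> 'w measure \<Rightarrow> ('w \<Rightarrow> 'i \<Rightarrow> real) \<Rightarrow> bool" where
  "exchangeable I M W \<longleftrightarrow>
    (\<forall>\<pi>. \<pi> permutes I \<longrightarrow>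
      distr M (Pi\<^sub>M I (\<lambda>_. borel)) (\<lambda>\<omega>. \<lambda>i\<in>I. W \<omega> (\<pi> i)) = distr M (Pi\<^sub>M I (\<lambda>_. borel)) W)"

end

theory Submission
  imports Defs "HOL-Real_Asymp.Real_Asymp"
begin

text \<open>Take independent standard normal magnitudes and, independently of them, signs whose set \<open>S\<close> of
  positive coordinates has probability \<open>a\<close> for \<open>S = \<emptyset>\<close> and \<open>S = {1,\<dots>,m}\<close>, and \<open>c\<^sub>m\<close> for each of the
  \<open>2\<^sup>m - 2\<close> other sets. This law is symmetric under complement and permutations, so the scores are
  exchangeable with standard normal margins. At level \<open>1/m\<close> a candidate \<open>t\<close> is admissible only if
  all \<open>m\<close> scores are at least \<open>t\<close>; hence knockoff+ rejects something iff all scores are positive, which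
  has probability \<open>a\<close>. Likewise \<open>\<A>\<^sub>q\<close> is \<open>{j}\<close> if \<open>W\<^sub>j\<close> is the only negative score and empty otherwise.
  In that event, of probability \<open>m c\<^sub>m\<close>, the odds are \<open>\<Omega>\<^sub>j = a / c\<^sub>m \<ge> 1\<close>, and off it the odds of the
  negative scores are at most \<open>1\<close>, since \<open>a \<ge> 1/4 \<ge> c\<^sub>m\<close>.\<close>

section \<open>The knockoff+ filter at level 1/m\<close>

text \<open>With m scores, \<open>N_plus\<close> is at most m and the numerator is at least 1, so a
  ratio of at most 1/m leaves no slack: \<open>N_plus\<close> must equal m.\<close>

lemma admissible_all_ge:
  assumes I: "finite I" "2 \<le> card I" and t: "t \<in> admissible I w (1 / real (card I))"
  shows "0 < t" and "\<forall>i\<in>I. t \<le> w i"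
proof -
  show "0 < t" using t by (auto simp: admissible_def candidates_def)
  have le: "N_plus I w t \<le> card I"
    unfolding N_plus_def by (intro card_mono I) auto
  have "(1 + real (N_minus I w t)) / real (max (N_plus I w t) 1) \<le> 1 / real (card I)"
    using t by (simp add: admissible_def)
  then have "(1 + real (N_minus I w t)) * real (card I) \<le> real (max (N_plus I w t) 1)"
    using I by (simp add: field_simps)
  moreover have "1 * real (card I) \<le> (1 + real (N_minus I w t)) * real (card I)"
    by (intro mult_right_mono) auto
  ultimately have "real (card I) \<le> real (max (N_plus I w t) 1)"
    by linarith
  \<comment> \<open>Because m is at least 2, the maximum with 1 can reach m only through
    \<open>N_plus\<close>.\<close>
  then have "N_plus I w t = card I"
    using I le by (simp add: max_def split: if_splits)
  then have "{i \<in> I. w i \<ge> t} = I"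
    unfolding N_plus_def by (intro card_subset_eq I) auto
  then show "\<forall>i\<in>I. t \<le> w i" by auto
qed

lemma finite_admissible: "finite I \<Longrightarrow> finite (admissible I w q)"
  by (rule finite_subset[of _ "(\<lambda>i. \<bar>w i\<bar>) ` I"]) (auto simp: admissible_def candidates_def)

lemma knockoff_threshold_not_all_positive:
  assumes I: "finite I" "2 \<le> card I" and w: "\<not> (\<forall>i\<in>I. 0 < w i)"
  shows "knockoff_threshold I w (1 / real (card I)) = \<infinity>"
proof -
  have "admissible I w (1 / real (card I)) = {}"
    using admissible_all_ge[OF I, of _ w] w by fastforce
  then show ?thesis by (simp add: knockoff_threshold_def)
qed

text \<open>The smallest score is itself a candidate, with \<open>N_plus\<close> equal to m,
  \<open>N_minus\<close> equal to 0 and ratio exactly 1/m. Hence the threshold is finite, and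
  \<open>admissible_all_ge\<close> bounds it.\<close>

lemma knockoff_threshold_all_positive:
  assumes I: "finite I" "2 \<le> card I" and w: "\<forall>i\<in>I. 0 < w i"
  obtains t where "knockoff_threshold I w (1 / real (card I)) = ereal t" "0 < t" "\<forall>i\<in>I. t \<le> w i"
proof -
  let ?A = "admissible I w (1 / real (card I))"
  define t where "t = Min (w ` I)"
  have "I \<noteq> {}" using I by auto
  then have "t \<in> w ` I" and le: "\<forall>i\<in>I. t \<le> w i"
    using I by (auto simp: t_def)
  then obtain k where k: "k \<in> I" "t = w k" by auto
  have "{i \<in> I. w i \<ge> t} = I" using le by auto
  then have "N_plus I w t = card I" by (simp add: N_plus_def)
  moreover have "{i \<in> I. w i \<le> - t} = {}" using w k le by force
  then have "N_minus I w t = 0" unfolding N_minus_def by (simp only: card.empty)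
  moreover have "t \<in> candidates I w" using k w by (force simp: candidates_def)
  ultimately have "t \<in> ?A" using I by (simp add: admissible_def)
  then have ne: "?A \<noteq> {}" by auto
  then have "Min ?A \<in> ?A" using finite_admissible[OF I(1)] by simp
  with ne show ?thesis
    using admissible_all_ge[OF I] by (intro that[of "Min ?A"]) (auto simp: knockoff_threshold_def)
qed

lemma rejections_reciprocal_card:
  assumes I: "finite I" "2 \<le> card I"
  shows "rejections I w (1 / real (card I)) = (if \<forall>i\<in>I. 0 < w i then I else {})"
proof (cases "\<forall>i\<in>I. 0 < w i")
  case True
  then obtain t where "knockoff_threshold I w (1 / real (card I)) = ereal t" "\<forall>i\<in>I. t \<le> w i"
    using knockoff_threshold_all_positive[OF I] by blast
  with True show ?thesis by (auto simp: rejections_def)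
next
  case False
  then show ?thesis
    using knockoff_threshold_not_all_positive[OF I False] by (auto simp: rejections_def)
qed

text \<open>After masking score j the threshold is finite only if every other score is positive and
  score j is nonzero. It is then some t with 0 < t \<le> \<open>\<bar>w j\<bar>\<close>, so being at
  most -t just means being negative. With an infinite threshold no real number is at most its
  negative.\<close>

lemma active_nulls_reciprocal_card:
  assumes I: "finite I" "2 \<le> card I"
  shows "active_nulls I I w (1 / real (card I)) = {j \<in> I. w j < 0 \<and> (\<forall>i\<in>I - {j}. 0 < w i)}"
proof -
  have "ereal (w j) \<le> - knockoff_threshold I (mask_sign j w) (1 / real (card I))
      \<longleftrightarrow> w j < 0 \<and> (\<forall>i\<in>I - {j}. 0 < w i)" if j: "j \<in> I" for j
  proof (cases "\<forall>i\<in>I. 0 < mask_sign j w i")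
    case True
    then obtain t where t: "knockoff_threshold I (mask_sign j w) (1 / real (card I)) = ereal t"
        "0 < t" "\<forall>i\<in>I. t \<le> mask_sign j w i"
      using knockoff_threshold_all_positive[OF I] by blast
    have "t \<le> \<bar>w j\<bar>" using t(3) j by (auto simp: mask_sign_def)
    moreover have "\<forall>i\<in>I - {j}. 0 < w i" using True by (auto simp: mask_sign_def split: if_splits)
    ultimately show ?thesis using t(1,2) by auto
  next
    case False
    then have "\<not> (w j < 0 \<and> (\<forall>i\<in>I - {j}. 0 < w i))"
      by (auto simp: mask_sign_def split: if_splits)
    then show ?thesis
      using knockoff_threshold_not_all_positive[OF I False] by simp
  qed
  then show ?thesis by (auto simp: active_nulls_def)
qed

section \<open>Normal magnitudes with an arbitrary law of the signs\<close>

definition std_normal :: "real measure" where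
  "std_normal = density lborel std_normal_density"

lemma sets_std_normal [simp, measurable_cong]: "sets std_normal = sets borel"
  and space_std_normal [simp]: "space std_normal = UNIV"
  by (simp_all add: std_normal_def)

lemma prob_space_std_normal: "prob_space std_normal"
  unfolding std_normal_def by (rule prob_space_normal_density) simp

interpretation std_normal: prob_space std_normal
  by (rule prob_space_std_normal)

lemma distr_std_normal_uminus: "distr std_normal std_normal uminus = std_normal"
proof -
  have "std_normal = density (distr lborel borel uminus) std_normal_density"
    by (simp add: std_normal_def lborel_distr_uminus)
  also have "\<dots> = distr (density lborel (\<lambda>x. ennreal (std_normal_density (- x)))) borel uminus"
    by (rule density_distr) auto
  also have "\<dots> = distr std_normal std_normal uminus"
    by (intro distr_cong) (simp_all add: std_normal_def std_normal_density_def)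
  finally show ?thesis ..
qed

lemma emeasure_std_normal_uminus:
  assumes "A \<in> sets borel"
  shows "emeasure std_normal (uminus -` A) = emeasure std_normal A"
proof -
  have "emeasure std_normal A = emeasure (distr std_normal std_normal uminus) A"
    by (simp add: distr_std_normal_uminus)
  also have "\<dots> = emeasure std_normal (uminus -` A)"
    using assms by (subst emeasure_distr) auto
  finally show ?thesis ..
qed

lemma measure_std_normal_zero: "measure std_normal {0} = 0"
proof -
  have "AE x in lborel. x \<in> {0::real} \<longrightarrow> ennreal (std_normal_density x) = 0"
    using AE_lborel_singleton[of "0::real"] by eventually_elim simp
  then have "{0} \<in> null_sets std_normal"
    unfolding std_normal_def by (subst null_sets_density_iff) auto
  then show ?thesis by (simp add: null_setsD1 measure_def)
qed

lemma measure_std_normal_split: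
  assumes "B \<in> sets borel"
  shows "measure std_normal (B \<inter> {0<..}) + measure std_normal (B \<inter> {..0}) = measure std_normal B"
proof -
  have "B = (B \<inter> {0<..}) \<union> (B \<inter> {..0})" by auto
  then show ?thesis
    using assms
    by (subst (3) \<open>B = _\<close>, subst std_normal.finite_measure_Union) auto
qed

text \<open>Reflection exchanges the two open half lines and zero carries no mass, so the two pieces
  are equal and sum to one.\<close>

lemma measure_std_normal_half:
  "measure std_normal {0<..} = 1/2" "measure std_normal {..0} = 1/2"
proof -
  have "uminus -` {0<..} = {..<0::real}" by auto
  then have "measure std_normal {0<..} = measure std_normal {..<0}"
    using emeasure_std_normal_uminus[of "{0<..}"] by (simp add: measure_def)
  also have "measure std_normal {..0} = measure std_normal ({..<0} \<union> {0})"
    by (rule arg_cong[where f="measure std_normal"]) auto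
  then have "measure std_normal {..<0} = measure std_normal {..0}"
    by (subst (asm) std_normal.finite_measure_Union) (auto simp: measure_std_normal_zero)
  finally have eq: "measure std_normal {0<..} = measure std_normal {..0}" .
  moreover have "measure std_normal {0<..} + measure std_normal {..0} = 1"
    using measure_std_normal_split[of UNIV] std_normal.prob_space by simp
  ultimately show "measure std_normal {0<..} = 1/2" "measure std_normal {..0} = 1/2" by simp_all
qed

interpretation normals: product_prob_space "\<lambda>_::'i. std_normal" I for I :: "'i set"
  by (simp add: product_prob_spaceI prob_space_std_normal product_prob_space_def product_prob_space_axioms_def
        product_sigma_finite_def prob_space_imp_sigma_finite)

text \<open>Zero is put on the \<open>False\<close> side, so the two sets partition the line and the
  points with a given set of positive coordinates form exactly a box of half lines.\<close>

definition half_line :: "bool \<Rightarrow> real set" where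
  "half_line b = (if b then {0<..} else {..0})"

lemma half_line_measurable [measurable]: "half_line b \<in> sets borel"
  by (simp add: half_line_def)

lemma mem_half_line: "y \<in> half_line b \<longleftrightarrow> (0 < y \<longleftrightarrow> b)"
  by (auto simp: half_line_def)

lemma measure_half_line: "measure std_normal (half_line b) = 1/2"
  by (simp add: half_line_def measure_std_normal_half)

text \<open>A set function with this property ignores membership of j. This serves both for
  invariance under flipping coordinate j and for measurability after masking its sign.\<close>

lemma eq_if_agree_outside:
  assumes g: "\<And>S. g (insert j S) = g (S - {j})" and eq: "S - {j} = T - {j}"
  shows "g S = g T"
proof -
  have "g S = g (S - {j})" for S
    using g[of S] by (cases "j \<in> S") (auto simp: insert_absorb)
  from this[of S] this[of T] eq show ?thesis by simp
qed

section \<open>Normal coordinates reweighted by a law \<open>p\<close> of the sign pattern\<close>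

locale sign_model =
  fixes I :: "'i set" and p :: "'i set \<Rightarrow> real"
  assumes finite_I: "finite I"
    and nonempty_I: "I \<noteq> {}"
    and p_pos: "0 < p S"
    and sum_p: "(\<Sum>S \<in> Pow I. p S) = 1"
begin

definition Q :: "('i \<Rightarrow> real) measure" where
  "Q = Pi\<^sub>M I (\<lambda>_. std_normal)"

definition positive :: "('i \<Rightarrow> real) \<Rightarrow> 'i set" where
  "positive x = {i \<in> I. x i > 0}"

text \<open>Under \<open>Q\<close> every orthant has mass \<open>2\<^sup>-\<^sup>|\<^sup>I\<^sup>|\<close>, so this weight gives the orthant with set \<open>S\<close> of
  positive coordinates the mass \<open>p S\<close>, while the magnitudes stay independent of the signs.\<close>

definition weight :: "('i \<Rightarrow> real) \<Rightarrow> real" where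
  "weight x = 2 ^ card I * p (positive x)"

definition P :: "('i \<Rightarrow> real) measure" where
  "P = density Q (\<lambda>x. ennreal (weight x))"

lemma sets_Q [simp, measurable_cong]: "sets Q = sets (Pi\<^sub>M I (\<lambda>_. borel))"
  unfolding Q_def by (rule sets_PiM_cong) simp_all

lemma sets_P [simp, measurable_cong]: "sets P = sets (Pi\<^sub>M I (\<lambda>_. borel))"
  by (simp add: P_def)

lemma space_Q: "space Q = Pi\<^sub>E I (\<lambda>_. UNIV)"
  by (simp add: Q_def space_PiM)

lemma space_P [simp]: "space P = space Q"
  by (simp add: P_def)

sublocale Q: prob_space Q
  unfolding Q_def by (rule prob_space_PiM) (rule prob_space_std_normal)

lemma positive_subset: "positive x \<subseteq> I"
  by (auto simp: positive_def)

lemma positive_eq_iff: "S \<subseteq> I \<Longrightarrow> positive x = S \<longleftrightarrow> (\<forall>i\<in>I. 0 < x i \<longleftrightarrow> i \<in> S)"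
  by (auto simp: positive_def)

text \<open>There are finitely many sign patterns, and the fibre over each is a box of half
  lines.\<close>

lemma measurable_positive [measurable]: "positive \<in> Pi\<^sub>M I (\<lambda>_. borel) \<rightarrow>\<^sub>M count_space (Pow I)"
proof (subst measurable_count_space_eq2)
  show "finite (Pow I)" using finite_I by simp
  have "positive -` {S} \<inter> space (Pi\<^sub>M I (\<lambda>_. borel)) \<in> sets (Pi\<^sub>M I (\<lambda>_. borel))" if "S \<subseteq> I" for S
  proof -
    have "positive -` {S} \<inter> space (Pi\<^sub>M I (\<lambda>_. borel)) = Pi\<^sub>E I (\<lambda>i. half_line (i \<in> S))"
      by (intro set_eqI) (auto simp: space_PiM PiE_iff mem_half_line positive_eq_iff[OF that])
    then show ?thesis
      by (auto intro!: sets_PiM_I_finite finite_I)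
  qed
  then show "positive \<in> space (Pi\<^sub>M I (\<lambda>_. borel)) \<rightarrow> Pow I \<and>
     (\<forall>a\<in>Pow I. positive -` {a} \<inter> space (Pi\<^sub>M I (\<lambda>_. borel)) \<in> sets (Pi\<^sub>M I (\<lambda>_. borel)))"
    using positive_subset by auto
qed

lemma measurable_of_positive [measurable]:
  fixes g :: "'i set \<Rightarrow> real"
  shows "(\<lambda>x. g (positive x)) \<in> borel_measurable (Pi\<^sub>M I (\<lambda>_. borel))"
  by (rule measurable_compose[OF measurable_positive]) simp

lemma measurable_weight [measurable]: "weight \<in> borel_measurable (Pi\<^sub>M I (\<lambda>_. borel))"
  unfolding weight_def by measurable

lemma weight_pos: "0 < weight x"
  by (simp add: weight_def p_pos)

lemma measurable_coord [measurable]: "i \<in> I \<Longrightarrow> (\<lambda>x. x i) \<in> borel_measurable (Pi\<^sub>M I (\<lambda>_. borel))"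
  by (rule measurable_component_singleton)

section \<open>Orthant masses and integrals of functions of the sign pattern\<close>

lemma bounded_of_positive:
  fixes g :: "'i set \<Rightarrow> real"
  shows "\<exists>C. \<forall>x. \<bar>g (positive x)\<bar> \<le> C"
proof (intro exI allI)
  fix x
  show "\<bar>g (positive x)\<bar> \<le> Max ((\<lambda>S. \<bar>g S\<bar>) ` Pow I)"
    using finite_I positive_subset by (intro Max_ge) auto
qed

text \<open>The event is a box: each of the other m - 1 coordinates contributes 1/2, which gives the
  factor 2 / 2^m.\<close>

lemma measure_Q_orthant:
  assumes i: "i \<in> I" and S: "S \<subseteq> I" and B: "B \<in> sets borel"
  shows "measure Q {x \<in> space Q. x i \<in> B \<and> positive x = S}
           = 2 * measure std_normal (B \<inter> half_line (i \<in> S)) / 2 ^ card I"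
proof -
  let ?A = "\<lambda>k. half_line (k \<in> S) \<inter> (if k = i then B else UNIV)"
  have "{x \<in> space Q. x i \<in> B \<and> positive x = S} = Pi\<^sub>E I ?A"
    using i by (intro set_eqI) (auto simp: space_Q PiE_iff mem_half_line positive_eq_iff[OF S])
  then have "emeasure Q {x \<in> space Q. x i \<in> B \<and> positive x = S} = (\<Prod>k\<in>I. emeasure std_normal (?A k))"
    unfolding Q_def using B finite_I by (subst normals.emeasure_PiM[symmetric]) auto
  also have "\<dots> = ennreal (\<Prod>k\<in>I. measure std_normal (?A k))"
    by (simp add: std_normal.emeasure_eq_measure prod_ennreal)
  finally have "measure Q {x \<in> space Q. x i \<in> B \<and> positive x = S} = (\<Prod>k\<in>I. measure std_normal (?A k))"
    by (simp add: measure_def prod_nonneg)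
  also have "\<dots> = measure std_normal (?A i) * (\<Prod>k\<in>I-{i}. measure std_normal (?A k))"
    using i finite_I by (rule prod.remove[rotated])
  also have "(\<Prod>k\<in>I-{i}. measure std_normal (?A k)) = (\<Prod>k\<in>I-{i}. 1/2)"
    by (rule prod.cong) (auto simp: measure_half_line)
  also have "\<dots> = (1/2) ^ (card I - 1)"
    using i finite_I by simp
  also have "\<dots> = 2 / 2 ^ card I"
    using i finite_I by (cases "card I") (auto simp: power_divide)
  finally show ?thesis by (simp add: Int_commute)
qed

lemma integrable_Q_mult_positive:
  fixes g :: "'i set \<Rightarrow> real"
  assumes [measurable]: "f \<in> borel_measurable (Pi\<^sub>M I (\<lambda>_. borel))" and f: "\<And>x. \<bar>f x\<bar> \<le> 1"
  shows "integrable Q (\<lambda>x. f x * g (positive x))"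
proof -
  obtain C where C: "\<And>x. \<bar>g (positive x)\<bar> \<le> C"
    using bounded_of_positive[of g] by auto
  show ?thesis
  proof (rule Q.integrable_const_bound)
    show "AE x in Q. norm (f x * g (positive x)) \<le> 1 * C"
      unfolding real_norm_def abs_mult by (intro AE_I2 mult_mono f C) auto
  qed measurable
qed

lemma integral_Q_indicator_positive:
  fixes g :: "'i set \<Rightarrow> real"
  assumes i: "i \<in> I" and B [measurable]: "B \<in> sets borel"
  shows "(\<integral>x. indicator B (x i) * g (positive x) \<partial>Q)
           = (\<Sum>S\<in>Pow I. g S * (2 * measure std_normal (B \<inter> half_line (i \<in> S)) / 2 ^ card I))"
proof -
  let ?E = "\<lambda>S. {x \<in> space Q. x i \<in> B \<and> positive x = S}"
  have E [measurable]: "?E S \<in> sets Q" if "S \<subseteq> I" for S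
    using that i by measurable
  have "(\<integral>x. indicator B (x i) * g (positive x) \<partial>Q)
      = (\<integral>x. (\<Sum>S\<in>Pow I. g S * indicator (?E S) x) \<partial>Q)"
  proof (rule Bochner_Integration.integral_cong)
    fix x assume x: "x \<in> space Q"
    \<comment> \<open>At a given point only the summand of its own sign pattern can survive.\<close>
    have "(\<Sum>S\<in>Pow I. g S * indicator (?E S) x)
        = (\<Sum>S\<in>Pow I. if S = positive x then g S * indicator B (x i) else 0)"
      using x by (intro sum.cong) (auto simp: indicator_def)
    also have "\<dots> = indicator B (x i) * g (positive x)"
      using finite_I positive_subset by (subst sum.delta) auto
    finally show "indicator B (x i) * g (positive x) = (\<Sum>S\<in>Pow I. g S * indicator (?E S) x)" ..
  qed simp
  also have "\<dots> = (\<Sum>S\<in>Pow I. g S * measure Q (?E S))"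
    using E by (subst Bochner_Integration.integral_sum)
      (auto simp: Q.emeasure_eq_measure intro!: sum.cong)
  also have "\<dots> = (\<Sum>S\<in>Pow I. g S * (2 * measure std_normal (B \<inter> half_line (i \<in> S)) / 2 ^ card I))"
    using i B by (intro sum.cong refl) (subst measure_Q_orthant; auto)
  finally show ?thesis .
qed

lemma integral_P:
  assumes [measurable]: "f \<in> borel_measurable (Pi\<^sub>M I (\<lambda>_. borel))"
  shows "(\<integral>x. f x \<partial>P) = (\<integral>x. weight x * f x \<partial>Q)"
  unfolding P_def by (subst integral_density) (auto intro: AE_I2 less_imp_le[OF weight_pos])

text \<open>One formula serves twice: the whole line as \<open>B\<close> yields total mass one, and
  a general \<open>B\<close> yields the margins. It is stated for \<open>emeasure\<close> since
  finiteness of \<open>P\<close> is only derived from it.\<close>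

lemma emeasure_P_coord:
  assumes i: "i \<in> I" and B [measurable]: "B \<in> sets borel"
  shows "emeasure P {x \<in> space P. x i \<in> B} = ennreal (\<Sum>S\<in>Pow I. 2 * p S * measure std_normal (B \<inter> half_line (i \<in> S)))"
proof -
  have A: "{x \<in> space Q. x i \<in> B} \<in> sets Q" using i by measurable
  have int: "integrable Q (\<lambda>x. indicator B (x i) * weight x)"
    unfolding weight_def using i by (intro integrable_Q_mult_positive) (auto simp: indicator_def)
  have "emeasure P {x \<in> space P. x i \<in> B} = (\<integral>\<^sup>+x. ennreal (weight x) * indicator {x \<in> space Q. x i \<in> B} x \<partial>Q)"
    unfolding P_def by (subst emeasure_density) (use A in auto)
  also have "\<dots> = (\<integral>\<^sup>+x. ennreal (indicator B (x i) * weight x) \<partial>Q)"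
    by (intro nn_integral_cong) (auto simp: indicator_def)
  also have "\<dots> = ennreal (\<integral>x. indicator B (x i) * weight x \<partial>Q)"
    using less_imp_le[OF weight_pos] by (intro nn_integral_eq_integral int) (auto intro!: AE_I2)
  also have "(\<integral>x. indicator B (x i) * weight x \<partial>Q) = (\<Sum>S\<in>Pow I. 2 * p S * measure std_normal (B \<inter> half_line (i \<in> S)))"
    unfolding weight_def using integral_Q_indicator_positive[OF i B, of "\<lambda>S. 2 ^ card I * p S"]
    by (auto intro!: sum.cong)
  finally show ?thesis .
qed

sublocale P: prob_space P
proof
  obtain i where i: "i \<in> I" using nonempty_I by auto
  have "emeasure P {x \<in> space P. x i \<in> UNIV} = ennreal (\<Sum>S\<in>Pow I. p S)"
    using i by (subst emeasure_P_coord) (auto simp: measure_half_line intro!: arg_cong[where f=ennreal] sum.cong)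
  then show "emeasure P (space P) = 1" by (simp add: sum_p)
qed

lemma integral_P_of_positive:
  fixes g :: "'i set \<Rightarrow> real"
  shows "(\<integral>x. g (positive x) \<partial>P) = (\<Sum>S\<in>Pow I. p S * g S)"
proof -
  obtain i where i: "i \<in> I" using nonempty_I by auto
  have "(\<integral>x. g (positive x) \<partial>P) = (\<integral>x. indicator UNIV (x i) * (2 ^ card I * p (positive x) * g (positive x)) \<partial>Q)"
    by (subst integral_P) (auto simp: weight_def)
  also have "\<dots> = (\<Sum>S\<in>Pow I. p S * g S)"
    using i by (subst integral_Q_indicator_positive[where g="\<lambda>S. 2 ^ card I * p S * g S"])
      (auto simp: measure_half_line intro!: sum.cong)
  finally show ?thesis .
qed

section \<open>Margins, joint density and exchangeability\<close>

lemma AE_Q_nonzero: "AE x in Q. \<forall>i\<in>I. x i \<noteq> 0"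
proof -
  have "AE y in std_normal. y \<noteq> 0"
    by (rule AE_I[of _ _ "{0}"]) (auto simp: std_normal.emeasure_eq_measure measure_std_normal_zero)
  then have "AE x in Q. x i \<noteq> 0" if "i \<in> I" for i
    unfolding Q_def using that by (rule normals.AE_component[rotated])
  then show ?thesis using finite_I by (simp add: AE_finite_all)
qed

lemma AE_P_nonzero: "AE x in P. \<forall>i\<in>I. x i \<noteq> 0"
  unfolding P_def using AE_Q_nonzero by (subst AE_density) auto

text \<open>A positive sign has probability 1/2, so each half of the normal law is reweighted by 2 *
  1/2 = 1, and the halves recombine to the normal law.\<close>

lemma marginal_P:
  assumes i: "i \<in> I" and half: "(\<Sum>S \<in> {S \<in> Pow I. i \<in> S}. p S) = 1/2"
  shows "distributed P lborel (\<lambda>x. x i) (\<lambda>x. ennreal (std_normal_density x))"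
  unfolding distributed_def
proof (intro conjI)
  have fin: "finite (Pow I)" using finite_I by simp
  have "(\<Sum>S\<in>Pow I. p S) = (\<Sum>S\<in>{S \<in> Pow I. i \<in> S}. p S) + (\<Sum>S\<in>{S \<in> Pow I. i \<notin> S}. p S)"
    using fin by (subst sum.union_disjoint[symmetric]) (auto intro: sum.cong)
  then have half': "(\<Sum>S \<in> {S \<in> Pow I. i \<notin> S}. p S) = 1/2" using sum_p half by simp
  have "distr P borel (\<lambda>x. x i) = std_normal"
  proof (rule measure_eqI)
    fix B assume "B \<in> sets (distr P borel (\<lambda>x. x i))"
    then have B: "B \<in> sets borel" by simp
    have "emeasure (distr P borel (\<lambda>x. x i)) B = emeasure P {x \<in> space P. x i \<in> B}"
      using i B by (subst emeasure_distr) (auto intro!: arg_cong2[where f=emeasure])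
    also have "\<dots> = ennreal (\<Sum>S\<in>Pow I. 2 * p S * measure std_normal (B \<inter> half_line (i \<in> S)))"
      by (rule emeasure_P_coord[OF i B])
    also have "(\<Sum>S\<in>Pow I. 2 * p S * measure std_normal (B \<inter> half_line (i \<in> S)))
      = (\<Sum>S\<in>{S \<in> Pow I. i \<in> S}. p S * (2 * measure std_normal (B \<inter> {0<..})))
        + (\<Sum>S\<in>{S \<in> Pow I. i \<notin> S}. p S * (2 * measure std_normal (B \<inter> {..0})))"
      using fin by (subst (1 2) sum.inter_filter) (auto simp: half_line_def sum.distrib[symmetric] intro!: sum.cong)
    also have "\<dots> = measure std_normal B"
      unfolding sum_distrib_right[symmetric] half half'
      using measure_std_normal_split[OF B] by simp
    finally show "emeasure (distr P borel (\<lambda>x. x i)) B = emeasure std_normal B"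
      by (simp add: std_normal.emeasure_eq_measure)
  qed simp
  then show "distr P lborel (\<lambda>x. x i) = density lborel (\<lambda>x. ennreal (std_normal_density x))"
    unfolding std_normal_def by (metis distr_cong sets_lborel)
  show "(\<lambda>x. ennreal (std_normal_density x)) \<in> borel_measurable lborel"
    by simp
  show "(\<lambda>x. x i) \<in> P \<rightarrow>\<^sub>M lborel"
    unfolding measurable_cong_sets[OF sets_P sets_lborel] by (rule measurable_coord[OF i])
qed

text \<open>A finite product measure is determined by its values on boxes, and there the integral of
  the product density factors over the coordinates.\<close>

lemma Q_eq_density:
  "Q = density (Pi\<^sub>M I (\<lambda>_. lborel)) (\<lambda>x. ennreal (\<Prod>i\<in>I. std_normal_density (x i)))"
proof -
  interpret L: product_sigma_finite "\<lambda>_::'i. lborel :: real measure" ..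
  have [measurable]: "(\<lambda>x. ennreal (\<Prod>i\<in>I. std_normal_density (x i))) \<in> borel_measurable (Pi\<^sub>M I (\<lambda>_. lborel))"
    by measurable
  have "density (Pi\<^sub>M I (\<lambda>_. lborel)) (\<lambda>x. ennreal (\<Prod>i\<in>I. std_normal_density (x i))) = Pi\<^sub>M I (\<lambda>_. std_normal)"
  proof (rule normals.PiM_eqI[OF finite_I], goal_cases)
    case 1
    show ?case
      unfolding sets_density by (rule sets_PiM_cong) simp_all
  next
    case (2 A)
    then have A [measurable]: "\<And>i. i \<in> I \<Longrightarrow> A i \<in> sets borel" by simp
    then have PA: "Pi\<^sub>E I A \<in> sets (Pi\<^sub>M I (\<lambda>_. lborel))"
      by (intro sets_PiM_I_finite finite_I) auto
    have "emeasure (density (Pi\<^sub>M I (\<lambda>_. lborel)) (\<lambda>x. ennreal (\<Prod>i\<in>I. std_normal_density (x i)))) (Pi\<^sub>E I A)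
       = (\<integral>\<^sup>+x. ennreal (\<Prod>i\<in>I. std_normal_density (x i)) * indicator (Pi\<^sub>E I A) x \<partial>Pi\<^sub>M I (\<lambda>_. lborel))"
      by (rule emeasure_density) (use PA in auto)
    also have "\<dots> = (\<integral>\<^sup>+x. (\<Prod>i\<in>I. ennreal (std_normal_density (x i)) * indicator (A i) (x i)) \<partial>Pi\<^sub>M I (\<lambda>_. lborel))"
    proof (rule nn_integral_cong)
      fix x :: "'i \<Rightarrow> real" assume "x \<in> space (Pi\<^sub>M I (\<lambda>_. lborel))"
      then have x: "x \<in> extensional I" by (simp add: space_PiM PiE_def)
      \<comment> \<open>The points of the space are extensional, so membership in the box is decided
        on \<open>I\<close> alone.\<close>
      have "indicator (Pi\<^sub>E I A) x = (\<Prod>i\<in>I. indicator (A i) (x i) :: ennreal)"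
        using x finite_I by (auto simp: indicator_def PiE_def Pi_def prod_zero_iff intro: prod_zero)
      then show "ennreal (\<Prod>i\<in>I. std_normal_density (x i)) * indicator (Pi\<^sub>E I A) x
        = (\<Prod>i\<in>I. ennreal (std_normal_density (x i)) * indicator (A i) (x i))"
        by (simp add: prod.distrib prod_ennreal)
    qed
    also have "\<dots> = (\<Prod>i\<in>I. emeasure std_normal (A i))"
      unfolding std_normal_def
      by (subst L.product_nn_integral_prod[OF finite_I]) (auto simp: emeasure_density intro!: prod.cong)
    finally show "emeasure (density (Pi\<^sub>M I (\<lambda>_. lborel)) (\<lambda>x. ennreal (\<Prod>i\<in>I. std_normal_density (x i)))) (Pi\<^sub>E I A)
       = (\<Prod>i\<in>I. emeasure std_normal (A i))" .
  qed
  then show ?thesis by (simp add: Q_def)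
qed

text \<open>The density is the product of the normal densities times \<open>weight\<close>; strict
  positivity of \<open>p\<close> makes it positive at every point.\<close>

lemma positive_density_P:
  "\<exists>f :: ('i \<Rightarrow> real) \<Rightarrow> real. (\<forall>x \<in> space (Pi\<^sub>M I (\<lambda>_. lborel)). f x > 0)
     \<and> distributed P (Pi\<^sub>M I (\<lambda>_. lborel)) (\<lambda>x. x) (\<lambda>x. ennreal (f x))"
proof (intro exI conjI ballI)
  let ?f = "\<lambda>x. (\<Prod>i\<in>I. std_normal_density (x i)) * weight x"
  show "0 < ?f x" for x
    by (intro mult_pos_pos prod_pos weight_pos) (simp add: normal_density_pos)
  have sets: "sets (Pi\<^sub>M I (\<lambda>_. lborel)) = sets (Pi\<^sub>M I (\<lambda>_. borel :: real measure))"
    by (rule sets_PiM_cong) simp_all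
  have [measurable]: "weight \<in> borel_measurable (Pi\<^sub>M I (\<lambda>_. lborel))"
    using measurable_weight by (simp add: measurable_cong_sets[OF sets refl])
  have "P = density (Pi\<^sub>M I (\<lambda>_. lborel)) (\<lambda>x. ennreal (?f x))"
    unfolding P_def Q_eq_density
    by (subst density_density_eq) (auto simp: ennreal_mult'' less_imp_le[OF weight_pos] intro!: density_cong)
  moreover have "distr P (Pi\<^sub>M I (\<lambda>_. lborel)) (\<lambda>x. x) = P"
    by (rule distr_id2) (simp add: sets)
  ultimately show "distributed P (Pi\<^sub>M I (\<lambda>_. lborel)) (\<lambda>x. x) (\<lambda>x. ennreal (?f x))"
    unfolding distributed_def using sets by (auto simp: measurable_ident_sets)
qed

text \<open>Permuting coordinates preserves the product measure \<open>Q\<close> and only relabels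
  the set of positive coordinates, so invariance of \<open>p\<close> makes \<open>weight\<close>
  invariant.\<close>

lemma exchangeable_P:
  assumes sym: "\<And>\<pi> S. \<pi> permutes I \<Longrightarrow> S \<subseteq> I \<Longrightarrow> p (\<pi> ` S) = p S"
  shows "exchangeable I P (\<lambda>x. x)"
  unfolding exchangeable_def
proof (intro allI impI)
  fix \<pi> assume \<pi>: "\<pi> permutes I"
  let ?T = "\<lambda>x. \<lambda>i\<in>I. x (\<pi> i) :: real"
  have T [measurable]: "?T \<in> Q \<rightarrow>\<^sub>M Q"
    unfolding Q_def using permutes_in_image[OF \<pi>]
    by (intro measurable_restrict measurable_component_singleton) simp
  have "distr Q Q ?T = Q"
    unfolding Q_def using \<pi>
    by (intro distr_PiM_reindex prob_space_std_normal)
       (auto simp: permutes_in_image[OF \<pi>] permutes_inj_on)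
  moreover have "weight (?T x) = weight x" for x
  proof -
    have "\<pi> ` positive (?T x) = positive x"
    proof (intro set_eqI iffI)
      fix k assume "k \<in> positive x"
      then show "k \<in> \<pi> ` positive (?T x)"
        using permutes_in_image[OF \<pi>, of "inv \<pi> k"] permutes_inverses(1)[OF \<pi>]
        by (intro image_eqI[of _ _ "inv \<pi> k"]) (auto simp: positive_def)
    qed (use permutes_in_image[OF \<pi>] in \<open>auto simp: positive_def\<close>)
    then show ?thesis
      using sym[OF \<pi> positive_subset, of "?T x"] by (simp add: weight_def)
  qed
  ultimately have "distr P Q ?T = P"
    unfolding P_def using density_distr[of "\<lambda>x. ennreal (weight x)" Q ?T Q] by simp
  then show "distr P (Pi\<^sub>M I (\<lambda>_. borel)) ?T = distr P (Pi\<^sub>M I (\<lambda>_. borel)) (\<lambda>x. x)"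
    by (metis distr_cong distr_id2 sets_P sets_Q)
qed

subsection \<open>Conditional sign probabilities\<close>

text \<open>On boxes, the reflection replaces side j by its mirror image, which has the same normal
  mass.\<close>

lemma distr_Q_flip:
  assumes j: "j \<in> I"
  shows "distr Q Q (\<lambda>x. x(j := - x j)) = Q"
proof -
  let ?T = "\<lambda>x::'i \<Rightarrow> real. x(j := - x j)"
  have T: "?T \<in> Q \<rightarrow>\<^sub>M Q"
    unfolding measurable_cong_sets[OF sets_Q sets_Q] using j
    by (intro measurable_fun_upd[where J=I]) auto
  have "distr Q Q ?T = Pi\<^sub>M I (\<lambda>_. std_normal)"
  proof (rule normals.PiM_eqI[OF finite_I], goal_cases)
    case 1
    show ?case by (simp add: Q_def)
  next
    case (2 A)
    let ?B = "A(j := uminus -` A j)"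
    have B: "?B i \<in> sets std_normal" if "i \<in> I" for i
      using 2[OF that] measurable_sets[of uminus borel borel "A j"] by auto
    have "emeasure (distr Q Q ?T) (Pi\<^sub>E I A) = emeasure Q (?T -` Pi\<^sub>E I A \<inter> space Q)"
      using T 2 finite_I by (intro emeasure_distr) (auto simp: Q_def)
    also have "?T -` Pi\<^sub>E I A \<inter> space Q = Pi\<^sub>E I ?B"
    proof (intro set_eqI)
      fix x :: "'i \<Rightarrow> real"
      have "(\<forall>i\<in>I. (x(j := - x j)) i \<in> A i) \<longleftrightarrow> (\<forall>i\<in>I. x i \<in> ?B i)"
        by (intro ball_cong) auto
      moreover have "x \<in> extensional I \<Longrightarrow> x(j := - x j) \<in> extensional I"
        using j by (auto simp: extensional_def)
      ultimately show "x \<in> ?T -` Pi\<^sub>E I A \<inter> space Q \<longleftrightarrow> x \<in> Pi\<^sub>E I ?B"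
        by (auto simp del: fun_upd_apply simp: space_Q PiE_iff)
    qed
    also have "emeasure Q (Pi\<^sub>E I ?B) = (\<Prod>i\<in>I. emeasure std_normal (?B i))"
      unfolding Q_def using B by (rule normals.emeasure_PiM[OF finite_I])
    also have "\<dots> = (\<Prod>i\<in>I. emeasure std_normal (A i))"
      using 2 by (intro prod.cong) (auto simp: emeasure_std_normal_uminus)
    finally show ?case .
  qed
  then show ?thesis by (simp add: Q_def)
qed

lemma integral_Q_flip:
  fixes f :: "('i \<Rightarrow> real) \<Rightarrow> real"
  assumes j: "j \<in> I" and f: "f \<in> borel_measurable (Pi\<^sub>M I (\<lambda>_. borel))"
  shows "(\<integral>x. f (x(j := - x j)) \<partial>Q) = (\<integral>x. f x \<partial>Q)"
proof -
  have T: "(\<lambda>x. x(j := - x j)) \<in> Q \<rightarrow>\<^sub>M Q"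
    unfolding measurable_cong_sets[OF sets_Q sets_Q] using j
    by (intro measurable_fun_upd[where J=I]) auto
  have "(\<integral>x. f x \<partial>Q) = (\<integral>x. f x \<partial>distr Q Q (\<lambda>x. x(j := - x j)))"
    by (simp add: distr_Q_flip[OF j])
  also have "\<dots> = (\<integral>x. f (x(j := - x j)) \<partial>Q)"
    using f by (intro integral_distr T) simp
  finally show ?thesis ..
qed

lemma positive_flip:
  "j \<in> I \<Longrightarrow> x j < 0 \<Longrightarrow> positive (x(j := - x j)) = insert j (positive x)"
  "0 \<le> x j \<Longrightarrow> positive (x(j := - x j)) = positive x - {j}"
  by (auto simp: positive_def)

text \<open>For a factor \<open>h\<close> even in coordinate j, both halves become integrals over
  \<open>x j > 0\<close> under \<open>Q\<close>: the positive half stays in place, and reflection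
  moves the negative one, whose weight becomes that of the pattern without j.\<close>

lemma integral_P_sign_half:
  fixes h :: "('i \<Rightarrow> real) \<Rightarrow> real"
  assumes j: "j \<in> I" and h [measurable]: "h \<in> borel_measurable (Pi\<^sub>M I (\<lambda>_. borel))"
    and inv: "\<And>x. x \<in> space Q \<Longrightarrow> h (x(j := - x j)) = h x"
  shows "(\<integral>x. h x * indicator {0<..} (x j) \<partial>P)
           = (\<integral>x. 2 ^ card I * p (insert j (positive x)) * (h x * indicator {0<..} (x j)) \<partial>Q)" (is ?pos)
    and "(\<integral>x. h x * indicator {..<0} (x j) \<partial>P)
           = (\<integral>x. 2 ^ card I * p (positive x - {j}) * (h x * indicator {0<..} (x j)) \<partial>Q)" (is ?neg)
proof -
  have [measurable]: "(\<lambda>x. x j) \<in> borel_measurable (Pi\<^sub>M I (\<lambda>_. borel))" using j by measurable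
  have "insert j (positive x) = positive x" if "0 < x j" for x
    using that j by (auto simp: positive_def)
  then show ?pos
    by (subst integral_P) (auto simp: weight_def indicator_def intro!: Bochner_Integration.integral_cong)
  have "(\<integral>x. h x * indicator {..<0} (x j) \<partial>P) = (\<integral>x. weight x * (h x * indicator {..<0} (x j)) \<partial>Q)"
    by (subst integral_P) auto
  also have "\<dots> = (\<integral>x. weight (x(j := - x j)) * (h (x(j := - x j)) * indicator {..<0} ((x(j := - x j)) j)) \<partial>Q)"
    by (rule integral_Q_flip[OF j, symmetric]) measurable
  also have "\<dots> = (\<integral>x. 2 ^ card I * p (positive x - {j}) * (h x * indicator {0<..} (x j)) \<partial>Q)"
    by (rule Bochner_Integration.integral_cong)
       (auto simp: weight_def indicator_def inv positive_flip less_imp_le)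
  finally show ?neg .
qed

lemma measurable_mask_sign:
  assumes "j \<in> I"
  shows "mask_sign j \<in> Pi\<^sub>M I (\<lambda>_. borel) \<rightarrow>\<^sub>M Pi\<^sub>M I (\<lambda>_. borel)"
  unfolding mask_sign_def using assms by (intro measurable_fun_upd[where J=I]) auto

lemma sets_masked_algebra:
  assumes j: "j \<in> I"
  shows "sets (masked_algebra I P (\<lambda>x. x) j)
           = {mask_sign j -` B \<inter> space P | B. B \<in> sets (Pi\<^sub>M I (\<lambda>_. borel))}"
  unfolding masked_algebra_def using j
  by (intro sets_vimage_algebra2) (auto simp: mask_sign_def space_Q space_PiM PiE_iff extensional_def)

lemma subalgebra_masked_algebra:
  assumes j: "j \<in> I"
  shows "subalgebra P (masked_algebra I P (\<lambda>x. x) j)"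
proof -
  have "mask_sign j \<in> P \<rightarrow>\<^sub>M Pi\<^sub>M I (\<lambda>_. borel)"
    using measurable_mask_sign[OF j] by (simp add: measurable_cong_sets[OF sets_P refl])
  then show ?thesis
    unfolding subalgebra_def sets_masked_algebra[OF j]
    by (auto simp: masked_algebra_def simp del: sets_P dest: measurable_sets)
qed

text \<open>Masking changes at most the membership of j, which \<open>g\<close> ignores; hence the
  function factors through \<open>mask_sign j\<close>.\<close>

lemma measurable_masked_algebra_of_positive:
  fixes g :: "'i set \<Rightarrow> real"
  assumes j: "j \<in> I" and g: "\<And>S. g (insert j S) = g (S - {j})"
  shows "(\<lambda>x. g (positive x)) \<in> borel_measurable (masked_algebra I P (\<lambda>x. x) j)"
proof -
  have "mask_sign j \<in> masked_algebra I P (\<lambda>x. x) j \<rightarrow>\<^sub>M Pi\<^sub>M I (\<lambda>_. borel)"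
    unfolding masked_algebra_def
    by (rule measurable_vimage_algebra1)
       (use j in \<open>auto simp: mask_sign_def space_Q space_PiM PiE_iff extensional_def\<close>)
  from measurable_compose[OF this measurable_of_positive]
  have "(\<lambda>x. g (positive (mask_sign j x))) \<in> borel_measurable (masked_algebra I P (\<lambda>x. x) j)" .
  moreover have "g (positive (mask_sign j x)) = g (positive x)" for x
  proof -
    have "positive (mask_sign j x) - {j} = positive x - {j}"
      by (auto simp: positive_def mask_sign_def)
    with g show ?thesis by (rule eq_if_agree_outside)
  qed
  ultimately show ?thesis by simp
qed

text \<open>Masking and flipping the sign of \<open>W\<^sub>j\<close> identifies a point with its mirror image, and the two
  carry weights proportional to \<open>p (S \<union> {j})\<close> and \<open>p (S - {j})\<close>. Bayes' rule then is the identity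
  that folds every integral over \<open>P\<close> onto the half space \<open>W\<^sub>j > 0\<close>.\<close>

lemma AE_sign_prob:
  assumes j: "j \<in> I"
  shows "AE x in P. pos_sign_prob I P (\<lambda>x. x) j x
           = p (insert j (positive x)) / (p (insert j (positive x)) + p (positive x - {j}))" (is ?pos)
    and "AE x in P. neg_sign_prob I P (\<lambda>x. x) j x
           = p (positive x - {j}) / (p (insert j (positive x)) + p (positive x - {j}))" (is ?neg)
proof -
  let ?F = "masked_algebra I P (\<lambda>x. x) j"
  interpret F: finite_measure_subalgebra P ?F
    by unfold_locales (rule subalgebra_masked_algebra[OF j])
  \<comment> \<open>\<open>u\<close> and \<open>v\<close> are the masses of the pattern with sign j
    made positive and made negative; neither depends on the sign of j itself.\<close>
  define u where "u S = p (insert j S)" for S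
  define v where "v S = p (S - {j})" for S
  have uv: "u (insert j S) = u (S - {j})" "v (insert j S) = v (S - {j})" for S
    by (simp_all add: u_def v_def insert_absorb)
  have pos: "0 < u S" "0 < v S" for S by (simp_all add: u_def v_def p_pos)
  have [measurable]: "(\<lambda>x. x j) \<in> borel_measurable (Pi\<^sub>M I (\<lambda>_. borel))" using j by measurable
  have inv: "g (positive (x(j := - x j))) = g (positive x)"
    if g: "\<And>S. g (insert j S) = g (S - {j})" for g :: "'i set \<Rightarrow> real" and x
  proof -
    have "positive (x(j := - x j)) - {j} = positive x - {j}"
      by (auto simp: positive_def)
    with g show ?thesis by (rule eq_if_agree_outside)
  qed
  \<comment> \<open>Points with \<open>x j = 0\<close> are null, so the integral is the sum of its
    two half-space parts, both folded onto \<open>x j > 0\<close>.\<close>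
  have split: "(\<integral>x. h x \<partial>P) = (\<integral>x. 2 ^ card I * (u (positive x) + v (positive x)) * (h x * indicator {0<..} (x j)) \<partial>Q)"
    if h [measurable]: "h \<in> borel_measurable (Pi\<^sub>M I (\<lambda>_. borel))" and bd: "\<And>x. \<bar>h x\<bar> \<le> 1"
      and hinv: "\<And>x. x \<in> space Q \<Longrightarrow> h (x(j := - x j)) = h x" for h :: "('i \<Rightarrow> real) \<Rightarrow> real"
  proof -
    have int: "integrable P (\<lambda>x. h x * indicator A (x j))" if [measurable]: "A \<in> sets borel" for A
    proof (rule P.integrable_const_bound[of _ 1])
      show "AE x in P. norm (h x * indicator A (x j)) \<le> 1"
        using bd by (intro AE_I2) (auto simp: indicator_def)
    qed measurable
    have intQ: "integrable Q (\<lambda>x. 2 ^ card I * g (positive x) * (h x * indicator {0<..} (x j)))"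
      for g :: "'i set \<Rightarrow> real"
    proof -
      have "integrable Q (\<lambda>x. (h x * indicator {0<..} (x j)) * (2 ^ card I * g (positive x)))"
        using bd by (intro integrable_Q_mult_positive) (auto simp: indicator_def)
      then show ?thesis by (simp add: mult.commute)
    qed
    have "(\<integral>x. h x \<partial>P) = (\<integral>x. h x * indicator {0<..} (x j) + h x * indicator {..<0} (x j) \<partial>P)"
    proof (rule integral_cong_AE)
      show "AE x in P. h x = h x * indicator {0<..} (x j) + h x * indicator {..<0} (x j)"
        using AE_P_nonzero by eventually_elim (use j in \<open>auto simp: indicator_def neq_iff\<close>)
    qed measurable
    also have "\<dots> = (\<integral>x. h x * indicator {0<..} (x j) \<partial>P) + (\<integral>x. h x * indicator {..<0} (x j) \<partial>P)"
      by (intro Bochner_Integration.integral_add int) auto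
    also have "\<dots> = (\<integral>x. 2 ^ card I * u (positive x) * (h x * indicator {0<..} (x j)) \<partial>Q)
                  + (\<integral>x. 2 ^ card I * v (positive x) * (h x * indicator {0<..} (x j)) \<partial>Q)"
      unfolding u_def v_def
      by (intro arg_cong2[where f="(+)"] integral_P_sign_half[where h=h] j h hinv)
    also have "\<dots> = (\<integral>x. 2 ^ card I * (u (positive x) + v (positive x)) * (h x * indicator {0<..} (x j)) \<partial>Q)"
      by (subst Bochner_Integration.integral_add[OF intQ intQ, symmetric]) (simp add: algebra_simps)
    finally show ?thesis .
  qed
  \<comment> \<open>Both signs are treated at once: \<open>H\<close> is the half line of the sign
    and \<open>d\<close> its folded weight. The candidate \<open>d / (u + v)\<close> is verified by
    integrating over the sets of the masked algebra.\<close>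
  have charact: "AE x in P. real_cond_exp P ?F (indicator {x \<in> space P. x j \<in> H}) x
                   = d (positive x) / (u (positive x) + v (positive x))"
    if H [measurable]: "H \<in> sets borel" and d: "\<And>S. 0 < d S" "\<And>S. d S \<le> u S + v S" "\<And>S. d (insert j S) = d (S - {j})"
      and half: "\<And>h. h \<in> borel_measurable (Pi\<^sub>M I (\<lambda>_. borel)) \<Longrightarrow> (\<And>x. x \<in> space Q \<Longrightarrow> h (x(j := - x j)) = h x)
        \<Longrightarrow> (\<integral>x. h x * indicator H (x j) \<partial>P) = (\<integral>x. 2 ^ card I * d (positive x) * (h x * indicator {0<..} (x j)) \<partial>Q)"
    for H and d :: "'i set \<Rightarrow> real"
  proof (rule F.real_cond_exp_charact)
    let ?g = "\<lambda>S. d S / (u S + v S)"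
    have g1: "\<bar>?g S\<bar> \<le> 1" for S
      using d(1,2)[of S] pos[of S] by (simp add: divide_le_eq)
    have ginv: "?g (insert j S) = ?g (S - {j})" for S by (simp add: uv d(3))
    have HP: "{x \<in> space P. x j \<in> H} \<in> sets P" by measurable
    show "integrable P (indicator {x \<in> space P. x j \<in> H} :: _ \<Rightarrow> real)"
      using HP by (simp add: P.emeasure_eq_measure)
    show "integrable P (\<lambda>x. ?g (positive x))"
      using g1 by (intro P.integrable_const_bound[of _ 1]) (auto simp: measurable_cong_sets[OF sets_P refl])
    show "(\<lambda>x. ?g (positive x)) \<in> borel_measurable ?F"
      by (rule measurable_masked_algebra_of_positive[OF j ginv])
    fix A assume A: "A \<in> sets ?F"
    then obtain B where B: "A = mask_sign j -` B \<inter> space P"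
      unfolding sets_masked_algebra[OF j] by auto
    have AP [measurable]: "A \<in> sets (Pi\<^sub>M I (\<lambda>_. borel))"
      using A subalgebra_masked_algebra[OF j] by (auto simp: subalgebra_def)
    \<comment> \<open>Such a set is a preimage under \<open>mask_sign j\<close>, which takes equal
      values at a point and at its mirror image.\<close>
    have Ainv: "indicator A (x(j := - x j)) = (indicator A x :: real)" if "x \<in> space Q" for x
      using that j by (auto simp: B indicator_def mask_sign_def space_Q PiE_iff extensional_def)
    have "(\<integral>x\<in>A. (indicator {x \<in> space P. x j \<in> H} x :: real) \<partial>P) = (\<integral>x. indicator A x * indicator H (x j) \<partial>P)"
      unfolding set_lebesgue_integral_def
      by (intro Bochner_Integration.integral_cong) (auto simp: indicator_def)
    also have "\<dots> = (\<integral>x. 2 ^ card I * d (positive x) * (indicator A x * indicator {0<..} (x j)) \<partial>Q)"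
      using Ainv by (intro half) auto
    also have "\<dots> = (\<integral>x. 2 ^ card I * (u (positive x) + v (positive x))
        * ((indicator A x * ?g (positive x)) * indicator {0<..} (x j)) \<partial>Q)"
    proof (intro Bochner_Integration.integral_cong refl)
      fix x
      let ?s = "u (positive x) + v (positive x)"
      have eq: "?s * ?g (positive x) = d (positive x)"
        using pos[of "positive x"] by simp
      have "2 ^ card I * ?s * ((indicator A x * ?g (positive x)) * indicator {0<..} (x j))
          = 2 ^ card I * (?s * ?g (positive x)) * (indicator A x * indicator {0<..} (x j))"
        by (simp only: mult_ac)
      then show "2 ^ card I * d (positive x) * (indicator A x * indicator {0<..} (x j))
          = 2 ^ card I * ?s * ((indicator A x * ?g (positive x)) * indicator {0<..} (x j))"
        by (simp only: eq)
    qed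
    also have "\<dots> = (\<integral>x. indicator A x * ?g (positive x) \<partial>P)"
    proof (rule split[symmetric])
      show "\<bar>indicator A x * ?g (positive x)\<bar> \<le> 1" for x
        using g1[of "positive x"] by (simp add: indicator_def)
      show "indicator A (x(j := - x j)) * ?g (positive (x(j := - x j))) = indicator A x * ?g (positive x)"
        if "x \<in> space Q" for x
        using Ainv[OF that] inv[of ?g, OF ginv] by simp
    qed measurable
    also have "\<dots> = (\<integral>x\<in>A. ?g (positive x) \<partial>P)"
      by (simp add: set_lebesgue_integral_def)
    finally show "(\<integral>x\<in>A. indicator {x \<in> space P. x j \<in> H} x \<partial>P) = (\<integral>x\<in>A. ?g (positive x) \<partial>P)" .
  qed
  have "AE x in P. real_cond_exp P ?F (indicator {x \<in> space P. x j \<in> {0<..}}) x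
                   = u (positive x) / (u (positive x) + v (positive x))"
  proof (rule charact)
    show "(\<integral>x. h x * indicator {0<..} (x j) \<partial>P)
        = (\<integral>x. 2 ^ card I * u (positive x) * (h x * indicator {0<..} (x j)) \<partial>Q)"
      if "h \<in> borel_measurable (Pi\<^sub>M I (\<lambda>_. borel))" "\<And>x. x \<in> space Q \<Longrightarrow> h (x(j := - x j)) = h x" for h
      unfolding u_def using that by (rule integral_P_sign_half(1)[OF j])
  qed (simp_all add: uv pos less_imp_le)
  then show ?pos by (simp add: pos_sign_prob_def u_def v_def)
  have "AE x in P. real_cond_exp P ?F (indicator {x \<in> space P. x j \<in> {..<0}}) x
                   = v (positive x) / (u (positive x) + v (positive x))"
  proof (rule charact)
    show "(\<integral>x. h x * indicator {..<0} (x j) \<partial>P)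
        = (\<integral>x. 2 ^ card I * v (positive x) * (h x * indicator {0<..} (x j)) \<partial>Q)"
      if "h \<in> borel_measurable (Pi\<^sub>M I (\<lambda>_. borel))" "\<And>x. x \<in> space Q \<Longrightarrow> h (x(j := - x j)) = h x" for h
      unfolding v_def using that by (rule integral_P_sign_half(2)[OF j])
  qed (simp_all add: uv pos less_imp_le)
  then show ?neg by (simp add: neg_sign_prob_def u_def v_def)
qed

lemma AE_sign_prob_pos:
  assumes "j \<in> I"
  shows "AE x in P. pos_sign_prob I P (\<lambda>x. x) j x > 0 \<and> neg_sign_prob I P (\<lambda>x. x) j x > 0"
  using AE_sign_prob[OF assms] by eventually_elim (simp add: p_pos add_pos_pos)

lemma AE_sign_odds:
  "AE x in P. \<forall>j\<in>I. sign_odds I P (\<lambda>x. x) j x = p (insert j (positive x)) / p (positive x - {j})"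
proof (intro AE_finite_allI finite_I)
  fix j assume "j \<in> I"
  from AE_sign_prob[OF this]
  show "AE x in P. sign_odds I P (\<lambda>x. x) j x = p (insert j (positive x)) / p (positive x - {j})"
  proof eventually_elim
    case (elim x)
    \<comment> \<open>The normaliser common to both probabilities is nonzero and cancels in their
      ratio.\<close>
    have "0 < p (insert j (positive x)) + p (positive x - {j})" by (intro add_pos_pos p_pos)
    with elim show ?case by (simp add: sign_odds_def)
  qed
qed

end

section \<open>The extremal sign law\<close>

locale extremal_model =
  fixes I :: "'i set" and a :: real
  assumes finite_I: "finite I" and card_I: "2 \<le> card I"
    and a_ge: "1/4 \<le> a" and a_less: "a < 1/2"
begin

definition c :: real where "c = (1 - 2 * a) / (2 ^ card I - 2)"

definition p :: "'i set \<Rightarrow> real" where "p S = (if S = {} \<or> S = I then a else c)"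

lemma four_le: "(4::real) \<le> 2 ^ card I"
  using power_increasing[OF card_I, of "2::real"] by simp

lemma a_pos: "0 < a" using a_ge by simp

lemma c_pos: "0 < c"
  using four_le a_less by (auto simp: c_def intro!: divide_pos_pos)

text \<open>From a \<ge> 1/4 comes 1 - 2a \<le> 2a, and \<open>2 ^ card I - 2\<close> is at least 2.
  The inequality decides on which side of 1 the odds lie in \<open>M_minus\<close>.\<close>

lemma c_le_a: "c \<le> a"
proof -
  have "1 - 2 * a \<le> a * 2" using a_ge by simp
  also have "\<dots> \<le> a * (2 ^ card I - 2)"
    using four_le a_pos by (intro mult_left_mono) auto
  finally show ?thesis using four_le by (simp add: c_def pos_divide_le_eq)
qed

lemma I_nonempty: "I \<noteq> {}" using card_I by auto

lemma sum_p: "(\<Sum>S\<in>Pow I. p S) = 1"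
proof -
  \<comment> \<open>The law is the constant \<open>c\<close> plus an excess \<open>a - c\<close> at
    the two distinct patterns \<open>{}\<close> and \<open>I\<close>.\<close>
  have "(\<Sum>S\<in>Pow I. p S) = (\<Sum>S\<in>Pow I. c + ((if S = {} then a - c else 0) + (if S = I then a - c else 0)))"
    using I_nonempty by (intro sum.cong) (auto simp: p_def)
  also have "\<dots> = 2 ^ card I * c + 2 * (a - c)"
    using finite_I by (simp add: sum.distrib card_Pow)
  also have "\<dots> = (2 ^ card I - 2) * c + 2 * a" by (simp add: algebra_simps)
  also have "\<dots> = 1" using four_le by (simp add: c_def)
  finally show ?thesis .
qed

sublocale sign_model I p
  by unfold_locales (use finite_I I_nonempty sum_p a_pos c_pos in \<open>auto simp: p_def\<close>)

text \<open>Complementation preserves \<open>p\<close> and exchanges the patterns containing i with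
  those avoiding it.\<close>

lemma sum_p_half:
  assumes i: "i \<in> I"
  shows "(\<Sum>S \<in> {S \<in> Pow I. i \<in> S}. p S) = 1/2"
proof -
  have "(\<Sum>S\<in>{S \<in> Pow I. i \<in> S}. p S) = (\<Sum>S\<in>{S \<in> Pow I. i \<notin> S}. p S)"
    using i by (intro sum.reindex_bij_witness[of _ "\<lambda>S. I - S" "\<lambda>S. I - S"]) (auto simp: p_def)
  moreover have "(\<Sum>S\<in>Pow I. p S) = (\<Sum>S\<in>{S \<in> Pow I. i \<in> S}. p S) + (\<Sum>S\<in>{S \<in> Pow I. i \<notin> S}. p S)"
    using finite_I by (subst sum.union_disjoint[symmetric]) (auto intro: sum.cong)
  ultimately show ?thesis using sum_p by simp
qed

lemma exchangeable: "exchangeable I P (\<lambda>x. x)"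
proof (rule exchangeable_P)
  fix \<pi> S assume \<pi>: "\<pi> permutes I" and S: "S \<subseteq> I"
  have "\<pi> ` S = I \<longleftrightarrow> S = I"
    using permutes_image[OF \<pi>] inj_image_eq_iff[OF permutes_inj[OF \<pi>], of S I] by simp
  then show "p (\<pi> ` S) = p S" by (simp add: p_def)
qed

section \<open>The values of \<open>FDR\<close>, \<open>I_functional\<close> and
  \<open>M_minus\<close>\<close>

lemma p_remove:
  assumes "j \<in> I"
  shows "p (I - {j}) = c"
proof -
  \<comment> \<open>With at least two indices, \<open>I - {j}\<close> is neither empty nor all of
    \<open>I\<close>.\<close>
  have "I \<noteq> {j}" using card_I by auto
  then show ?thesis using assms by (auto simp: p_def)
qed

text \<open>The map from j to \<open>I - {j}\<close> is injective, so there are m such patterns,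
  each of mass \<open>c\<close>. It is applied with t = a/c and with t = a/c - 1.\<close>

lemma sum_p_one_negative:
  "(\<Sum>S\<in>Pow I. p S * (if \<exists>j\<in>I. S = I - {j} then t else 0)) = real (card I) * (c * t)"
proof -
  have "(\<Sum>S\<in>Pow I. p S * (if \<exists>j\<in>I. S = I - {j} then t else 0))
      = (\<Sum>S\<in>(\<lambda>j. I - {j}) ` I. c * t)"
    using finite_I p_remove by (intro sum.mono_neutral_cong_right) auto
  also have "\<dots> = real (card ((\<lambda>j. I - {j}) ` I)) * (c * t)" by simp
  also have "card ((\<lambda>j. I - {j}) ` I) = card I"
    by (rule card_image) (auto simp: inj_on_def)
  finally show ?thesis .
qed

text \<open>All indices are null and rejection is all or nothing, so the false discovery proportion
  is the indicator that all scores are positive.\<close>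

lemma FDR_eq: "FDR I I P (\<lambda>x. x) (1 / real (card I)) = a"
proof -
  have "FDR I I P (\<lambda>x. x) (1 / real (card I)) = (\<integral>x. (if positive x = I then 1 else 0) \<partial>P)"
    unfolding FDR_def
  proof (intro Bochner_Integration.integral_cong refl)
    fix x :: "'i \<Rightarrow> real"
    have "positive x = I \<longleftrightarrow> (\<forall>i\<in>I. 0 < x i)" by (auto simp: positive_def)
    then show "real (card (rejections I x (1 / real (card I)) \<inter> I))
        / real (max (card (rejections I x (1 / real (card I)))) 1) = (if positive x = I then 1 else 0)"
      using card_I by (simp add: rejections_reciprocal_card[OF finite_I card_I])
  qed
  also have "\<dots> = (\<Sum>S\<in>Pow I. if S = I then a else 0)"
    by (subst integral_P_of_positive) (auto simp: p_def intro!: sum.cong)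
  also have "\<dots> = a" using finite_I by simp
  finally show ?thesis .
qed

text \<open>The explicit odds are known only almost surely, and substituting them under an integral
  requires the original odds to be measurable too.\<close>

lemma measurable_sign_odds [measurable]:
  assumes "j \<in> I"
  shows "sign_odds I P (\<lambda>x. x) j \<in> borel_measurable P"
  unfolding sign_odds_def pos_sign_prob_def neg_sign_prob_def by measurable

lemma positive_eq_remove_iff:
  assumes x: "\<forall>i\<in>I. x i \<noteq> 0" and j: "j \<in> I"
  shows "positive x = I - {j} \<longleftrightarrow> x j < 0 \<and> (\<forall>i\<in>I - {j}. 0 < x i)"
  using assms by (auto simp: positive_def neq_iff)

text \<open>The only possible active null is a lone negative score, whose odds are a/c; the m
  patterns of mass \<open>c\<close> contribute m * c * (a/c) = m * a.\<close>

lemma I_functional_eq: "I_functional I I P (\<lambda>x. x) (1 / real (card I)) = real (card I) * a"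
proof -
  let ?one = "\<lambda>x j. x j < (0::real) \<and> (\<forall>i\<in>I - {j}. 0 < x i)"
  let ?o = "\<lambda>x j. sign_odds I P (\<lambda>x. x) j x"
  have "I_functional I I P (\<lambda>x. x) (1 / real (card I)) = (\<integral>x. (\<Sum>j\<in>I. if ?one x j then ?o x j else 0) \<partial>P)"
    unfolding I_functional_def
  proof (intro Bochner_Integration.integral_cong refl)
    fix x :: "'i \<Rightarrow> real"
    let ?A = "active_nulls I I x (1 / real (card I))"
    have A: "?A = {j \<in> I. ?one x j}" by (rule active_nulls_reciprocal_card[OF finite_I card_I])
    have "(\<Sum>j\<in>I. if ?one x j then ?o x j else 0) = (\<Sum>j\<in>?A. ?o x j)"
      unfolding A using finite_I by (simp add: sum.inter_filter)
    \<comment> \<open>Two distinct active nulls would each force the other to be positive, so the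
      average has a single term.\<close>
    moreover have "card ?A = 1" if ne: "?A \<noteq> {}"
    proof -
      obtain k where k: "k \<in> ?A" using ne by auto
      have "j = k" if "j \<in> ?A" for j
      proof (rule ccontr)
        assume "j \<noteq> k"
        then have "0 < x k" "x k < 0" using that k by (auto simp: A)
        then show False by simp
      qed
      with k have "?A = {k}" by blast
      then show ?thesis by simp
    qed
    ultimately show "(if ?A \<noteq> {} then 1 / real (card ?A) * (\<Sum>j\<in>?A. ?o x j) else 0)
        = (\<Sum>j\<in>I. if ?one x j then ?o x j else 0)"
      by auto
  qed
  also have "\<dots> = (\<integral>x. (if \<exists>j\<in>I. positive x = I - {j} then a / c else 0) \<partial>P)"
  proof (rule integral_cong_AE)
    have "(\<lambda>x. if ?one x j then ?o x j else 0) \<in> borel_measurable P" if j: "j \<in> I" for j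
    proof -
      note [measurable] = measurable_sign_odds[OF j] measurable_coord[OF j]
      \<comment> \<open>For measurability the condition is expressed through \<open>x j\<close> and
        the sign pattern; the pattern alone would also admit \<open>x j = 0\<close>.\<close>
      have "?one x j \<longleftrightarrow> x j < 0 \<and> positive x = I - {j}" for x
        using j by (auto simp: positive_def)
      then have "(\<lambda>x. if ?one x j then ?o x j else 0)
          = (\<lambda>x. indicator {..<0} (x j) * (if positive x = I - {j} then 1 else 0) * ?o x j)"
        by (intro ext) (simp add: indicator_def)
      moreover have "(\<lambda>x. indicator {..<0} (x j) * (if positive x = I - {j} then 1 else 0) * ?o x j)
          \<in> borel_measurable P"
        by measurable
      ultimately show ?thesis by simp
    qed
    then show "(\<lambda>x. \<Sum>j\<in>I. if ?one x j then ?o x j else 0) \<in> borel_measurable P"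
      by (rule borel_measurable_sum)
    show "(\<lambda>x. if \<exists>j\<in>I. positive x = I - {j} then a / c else 0) \<in> borel_measurable P"
      unfolding measurable_cong_sets[OF sets_P refl]
      by (rule measurable_of_positive[where g="\<lambda>S. if \<exists>j\<in>I. S = I - {j} then a / c else 0"])
    show "AE x in P. (\<Sum>j\<in>I. if ?one x j then ?o x j else 0)
        = (if \<exists>j\<in>I. positive x = I - {j} then a / c else 0)"
      using AE_P_nonzero AE_sign_odds
    proof eventually_elim
      case (elim x)
      have "(if ?one x j then ?o x j else 0) = (if positive x = I - {j} then a / c else 0)" if "j \<in> I" for j
        using that elim positive_eq_remove_iff[OF elim(1) that]
        by (auto simp: p_remove insert_absorb p_def[of I])
      then have eq: "(\<Sum>j\<in>I. if ?one x j then ?o x j else 0) = (\<Sum>j\<in>I. if positive x = I - {j} then a / c else 0)"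
        by (intro sum.cong) auto
      show ?case
      proof (cases "\<exists>j\<in>I. positive x = I - {j}")
        case True
        then obtain k where k: "k \<in> I" "positive x = I - {k}" by auto
        then have "(\<Sum>j\<in>I. if positive x = I - {j} then a / c else 0) = (\<Sum>j\<in>I. if j = k then a / c else 0)"
          by (intro sum.cong) auto
        with eq k finite_I show ?thesis by auto
      qed (use eq in auto)
    qed
  qed
  also have "\<dots> = real (card I) * (c * (a / c))"
    by (subst integral_P_of_positive) (rule sum_p_one_negative)
  also have "\<dots> = real (card I) * a" using c_pos by simp
  finally show ?thesis .
qed

lemma M_minus_eq: "M_minus I I P (\<lambda>x. x) = 1 + real (card I) * (a - c)"
proof -
  let ?o = "\<lambda>x j. sign_odds I P (\<lambda>x. x) j x"
  \<comment> \<open>Giving nonnegative scores the value 1 turns the maximum over a varying index set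
    into one over all of \<open>I\<close>; the default 0 for the empty set is absorbed by the
    maximum with 1.\<close>
  let ?F = "\<lambda>x j. if x j < (0::real) then max 1 (?o x j) else 1"
  \<comment> \<open>Writing a/c as 1 plus an excess lets the total mass give the leading 1, while
    the excess gives m * c * (a/c - 1) = m * (a - c).\<close>
  let ?g = "\<lambda>S. 1 + (if \<exists>j\<in>I. S = I - {j} then a / c - 1 else 0)"
  have "M_minus I I P (\<lambda>x. x) = (\<integral>x. Max (?F x ` I) \<partial>P)"
    unfolding M_minus_def
  proof (intro Bochner_Integration.integral_cong refl)
    fix x :: "'i \<Rightarrow> real"
    let ?N = "{j \<in> I. x j < 0}"
    show "max 1 (if ?N = {} then 0 else Max (?o x ` ?N)) = Max (?F x ` I)"
    proof (cases "?N = {}")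
      case True
      then have "?F x ` I = {1}" using I_nonempty by auto
      then have F1: "Max (?F x ` I) = 1" by (simp only: Max_singleton)
      show ?thesis unfolding F1 using True by simp
    next
      case False
      have fin: "finite (?o x ` ?N)" using finite_I by simp
      then have "Max (?o x ` ?N) \<in> ?o x ` ?N" using False by (intro Max_in) auto
      then obtain k where k: "k \<in> ?N" "Max (?o x ` ?N) = ?o x k" by auto
      have le: "?o x j \<le> ?o x k" if "j \<in> ?N" for j
        using Max_ge[OF fin imageI[OF that]] k(2) by simp
      have Fk: "Max (?F x ` I) = max 1 (?o x k)"
      proof (rule Max_eqI)
        fix y assume "y \<in> ?F x ` I"
        then show "y \<le> max 1 (?o x k)"
          using le by (auto intro: max.mono)
      qed (use finite_I k in auto)
      show ?thesis unfolding Fk k(2) by (simp only: False if_False)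
    qed
  qed
  also have "\<dots> = (\<integral>x. ?g (positive x) \<partial>P)"
  proof (rule integral_cong_AE)
    show "(\<lambda>x. Max (?F x ` I)) \<in> borel_measurable P"
      using finite_I by (intro borel_measurable_Max) measurable
    show "(\<lambda>x. ?g (positive x)) \<in> borel_measurable P"
      unfolding measurable_cong_sets[OF sets_P refl] by (rule measurable_of_positive[where g="?g"])
    show "AE x in P. Max (?F x ` I) = ?g (positive x)"
      using AE_P_nonzero AE_sign_odds
    proof eventually_elim
      case (elim x)
      let ?S = "positive x"
      have F: "?F x j = (if ?S = I - {j} then a / c else 1)" if j: "j \<in> I" for j
      proof (cases "x j < 0")
        case False
        then have "0 < x j" using j elim(1) False by (auto simp: neq_iff)
        then have "j \<in> ?S" using j by (simp add: positive_def)
        then have "?S \<noteq> I - {j}" by blast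
        then show ?thesis using False by simp
      next
        case True
        then have jS: "j \<notin> ?S" by (simp add: positive_def)
        then have o: "?o x j = p (insert j ?S) / p ?S" using elim(2) j by simp
        show ?thesis
        proof (cases "?S = I - {j}")
          case True
          then show ?thesis
            using \<open>x j < 0\<close> o j c_le_a c_pos by (simp add: p_remove insert_absorb p_def[of I] max_def)
        next
          case False
          \<comment> \<open>Some other index is also missing from the pattern, so adding j does not
            fill \<open>I\<close>. The numerator is then \<open>c\<close>, while the denominator is
            \<open>a\<close> or \<open>c\<close>, hence at least \<open>c\<close>.\<close>
          then have "insert j ?S \<noteq> I" using jS by auto
          then have "p (insert j ?S) = c" by (simp add: p_def)
          moreover have "c \<le> p ?S" by (simp add: p_def c_le_a)
          ultimately have "?o x j \<le> 1" using o p_pos[of ?S] by simp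
          then show ?thesis using False by simp
        qed
      qed
      show ?case
      proof (cases "\<exists>j\<in>I. ?S = I - {j}")
        case True
        then obtain k where k: "k \<in> I" "?S = I - {k}" by auto
        \<comment> \<open>Coordinate k contributes a/c and all others 1, so the maximum is a/c once
          this is at least 1.\<close>
        have "1 \<le> a / c" using c_le_a c_pos by simp
        then have Fx: "Max (?F x ` I) = a / c"
          using F k finite_I by (intro Max_eqI) (auto simp del: if_image_distrib intro!: image_eqI[of _ _ k])
        show ?thesis unfolding Fx using True by simp
      next
        case False
        then have "?F x ` I = {1}" using F I_nonempty by force
        then have Fx: "Max (?F x ` I) = 1" by (simp only: Max_singleton)
        show ?thesis unfolding Fx using False by simp
      qed
    qed
  qed
  also have "\<dots> = (\<Sum>S\<in>Pow I. p S) + (\<Sum>S\<in>Pow I. p S * (if \<exists>j\<in>I. S = I - {j} then a / c - 1 else 0))"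
    by (subst integral_P_of_positive) (simp only: distrib_left mult_1_right sum.distrib)
  also have "\<dots> = 1 + real (card I) * (a - c)"
    unfolding sum_p sum_p_one_negative using c_pos by (simp add: right_diff_distrib)
  finally show ?thesis .
qed

end

section \<open>Assembly of the properties for each m, and the limit\<close>

theorem proposition9:
  fixes a :: real and q c :: "nat \<Rightarrow> real"
  assumes "1 / 4 \<le> a" and "a < 1 / 2"
    and "q = (\<lambda>m. 1 / real m)"
    and "c = (\<lambda>m. (1 - 2 * a) / (2 ^ m - 2))"
  shows "\<exists>(P :: nat \<Rightarrow> (nat \<Rightarrow> real) measure) (W :: nat \<Rightarrow> (nat \<Rightarrow> real) \<Rightarrow> nat \<Rightarrow> real).
    (\<forall>m\<ge>2.
        prob_space (P m)
      \<and> W m \<in> P m \<rightarrow>\<^sub>M Pi\<^sub>M {1..m} (\<lambda>_. borel)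
      \<and> exchangeable {1..m} (P m) (W m)
      \<and> (\<forall>i\<in>{1..m}. distributed (P m) lborel (\<lambda>\<omega>. W m \<omega> i) (\<lambda>x. ennreal (std_normal_density x)))
      \<and> (\<exists>f :: (nat \<Rightarrow> real) \<Rightarrow> real.
            (\<forall>x \<in> space (Pi\<^sub>M {1..m} (\<lambda>_. lborel)). f x > 0)
          \<and> distributed (P m) (Pi\<^sub>M {1..m} (\<lambda>_. lborel)) (W m) (\<lambda>x. ennreal (f x)))
      \<and> (\<forall>j\<in>{1..m}. AE \<omega> in P m.
            pos_sign_prob {1..m} (P m) (W m) j \<omega> > 0 \<and> neg_sign_prob {1..m} (P m) (W m) j \<omega> > 0)
      \<and> FDR {1..m} {1..m} (P m) (W m) (q m) = q m * I_functional {1..m} {1..m} (P m) (W m) (q m)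
      \<and> q m * I_functional {1..m} {1..m} (P m) (W m) (q m) = a
      \<and> M_minus {1..m} {1..m} (P m) (W m) = 1 + real m * (a - c m)
      \<and> FDR {1..m} {1..m} (P m) (W m) (q m) / (q m * M_minus {1..m} {1..m} (P m) (W m))
          = a / (a - c m + 1 / real m))
    \<and> (\<lambda>m. FDR {1..m} {1..m} (P m) (W m) (q m) / (q m * M_minus {1..m} {1..m} (P m) (W m)))
        \<longlonglongrightarrow> 1
    \<and> q \<longlonglongrightarrow> 0"
proof -
  define P where "P m = sign_model.P {1..m} (extremal_model.p {1..m} a)" for m :: nat
  \<comment> \<open>The sample space is the score space itself, with the identity as score
    vector.\<close>
  define W :: "nat \<Rightarrow> (nat \<Rightarrow> real) \<Rightarrow> nat \<Rightarrow> real" where "W = (\<lambda>m \<omega>. \<omega>)"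
  let ?r = "\<lambda>m. FDR {1..m} {1..m} (P m) (W m) (q m) / (q m * M_minus {1..m} {1..m} (P m) (W m))"
  let ?Q = "\<lambda>m. prob_space (P m)
      \<and> W m \<in> P m \<rightarrow>\<^sub>M Pi\<^sub>M {1..m} (\<lambda>_. borel)
      \<and> exchangeable {1..m} (P m) (W m)
      \<and> (\<forall>i\<in>{1..m}. distributed (P m) lborel (\<lambda>\<omega>. W m \<omega> i) (\<lambda>x. ennreal (std_normal_density x)))
      \<and> (\<exists>f :: (nat \<Rightarrow> real) \<Rightarrow> real.
            (\<forall>x \<in> space (Pi\<^sub>M {1..m} (\<lambda>_. lborel)). f x > 0)
          \<and> distributed (P m) (Pi\<^sub>M {1..m} (\<lambda>_. lborel)) (W m) (\<lambda>x. ennreal (f x)))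
      \<and> (\<forall>j\<in>{1..m}. AE \<omega> in P m.
            pos_sign_prob {1..m} (P m) (W m) j \<omega> > 0 \<and> neg_sign_prob {1..m} (P m) (W m) j \<omega> > 0)
      \<and> FDR {1..m} {1..m} (P m) (W m) (q m) = q m * I_functional {1..m} {1..m} (P m) (W m) (q m)
      \<and> q m * I_functional {1..m} {1..m} (P m) (W m) (q m) = a
      \<and> M_minus {1..m} {1..m} (P m) (W m) = 1 + real m * (a - c m)
      \<and> ?r m = a / (a - c m + 1 / real m)"
  have main: "?Q m" if m: "2 \<le> m" for m
  proof -
    interpret E: extremal_model "{1..m}" a
      using assms(1,2) m by unfold_locales auto
    have P: "P m = E.P" by (simp add: P_def)
    have W: "W m = (\<lambda>x. x)" by (simp add: W_def)
    have q: "q m = 1 / real (card {1..m})" and c: "c m = E.c"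
      unfolding assms(3,4) E.c_def by simp_all
    have fdr: "FDR {1..m} {1..m} E.P (\<lambda>x. x) (q m) = a"
      and I: "I_functional {1..m} {1..m} E.P (\<lambda>x. x) (q m) = real m * a"
      and M: "M_minus {1..m} {1..m} E.P (\<lambda>x. x) = 1 + real m * (a - c m)"
      unfolding q c using E.FDR_eq E.I_functional_eq E.M_minus_eq by simp_all
    have qm: "q m * real m = 1" using m q by simp
    \<comment> \<open>As \<open>q m * real m = 1\<close>, this turns \<open>q m\<close> times
      \<open>M_minus\<close> into the denominator of the claimed ratio.\<close>
    have "q m * (1 + real m * (a - c m)) = a - c m + 1 / real m"
      using qm assms(3) by (simp add: distrib_left mult.assoc[symmetric])
    moreover have "(\<lambda>x. x) \<in> E.P \<rightarrow>\<^sub>M Pi\<^sub>M {1..m} (\<lambda>_. borel)"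
      by (intro measurable_ident_sets E.sets_P)
    moreover have "distributed E.P lborel (\<lambda>x. x i) (\<lambda>x. ennreal (std_normal_density x))" if "i \<in> {1..m}" for i
      using that by (intro E.marginal_P E.sum_p_half)
    ultimately show ?thesis
      unfolding P W fdr I M
      using E.P.prob_space_axioms E.exchangeable E.positive_density_P E.AE_sign_prob_pos qm
      by (simp add: mult.assoc[symmetric])
  qed
  \<comment> \<open>\<open>c m\<close> decays exponentially and 1/m vanishes, while a is a fixed
    positive number.\<close>
  have "(\<lambda>m. a / (a - c m + 1 / real m)) \<longlonglongrightarrow> 1"
    unfolding assms(4) using assms(1) by real_asymp
  moreover have "?r m = a / (a - c m + 1 / real m)" if "2 \<le> m" for m
    using main[OF that] by (elim conjE)
  \<comment> \<open>The ratio formula is established from m = 2 on, so the limits are compared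
    eventually.\<close>
  ultimately have "?r \<longlonglongrightarrow> 1"
    by (elim Lim_transform_eventually) (intro eventually_sequentiallyI[of 2], simp only:)
  moreover have "q \<longlonglongrightarrow> 0"
    unfolding assms(3) by (rule lim_1_over_n)
  ultimately show ?thesis
    using main by blast
qed

end
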